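(* Let $\mathcal O$ be a Prior-LTL ontology and let $\varkappa$ be a Prior-LTL formula. Then the ontology-mediated query $\boldsymbol q=(\mathcal O,\varkappa)$ is $\mathrm{FO}(<)$-rewritable. That is, there is a constant-free $\mathrm{FO}(<)$-formula $\boldsymbol Q(t)$ with a single free variable $t$ such that, for every data instance $\mathcal A$, $\mathrm{ans}(\boldsymbol q,\mathcal A)=\{\ell\in\mathrm{tem}(\mathcal A)\mid \mathfrak S_{\mathcal A}\models\boldsymbol Q(\ell)\}$.
   Context: Fix a countably infinite set of atomic concepts $A_i$, $i<\omega$. A (temporal) interpretation $\mathfrak M$ assigns to every atomic concept $A$ a set $A^{\mathfrak M}\subseteq\mathbb Z$. Prior-LTL formulas are built from atomic concepts using arbitrary Boolean connectives and the unary operators $\Box_F$ (always in the future), $\Box_P$ (always in the past), $\Diamond_F$ (some time in the future), $\Diamond_P$ (some time in the past). The extension $\varkappa^{\mathfrak M}\subseteq\mathbb Z$ of a formula is defined by interpreting the Booleans set-theoretically (negation is complement in $\mathbb Z$) and, with strict semantics, $(\Box_F\varkappa)^{\mathfrak M}=\{n\mid k\in\varkappa^{\mathfrak M}\text{ for all }k>n\}$, $(\Diamond_F\varkappa)^{\mathfrak M}=\{n\mid k\in\varkappa^{\mathfrak M}\text{ for some }k>n\}$, and symmetrically for $\Box_P,\Diamond_P$ with $k<n$. A Prior-LTL ontology $\mathcal O$ is a finite set of Prior-LTL formulas (axioms), interpreted globally: $\mathfrak M$ is a model of $\mathcal O$ if $\alpha^{\mathfrak M}=\mathbb Z$ for all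 $\alpha\in\mathcal O$. A data instance $\mathcal A$ is a finite set of ground atoms $A_i(\ell)$ with $\ell\in\mathbb Z$; $\min\mathcal A$ and $\max\mathcal A$ are the least and greatest integers occurring in it, and it is assumed throughout that $\min\mathcal A=0$ and $\max\mathcal A\ge 1$. Its active domain is $\mathrm{tem}(\mathcal A)=\{n\in\mathbb Z\mid\min\mathcal A\le n\le\max\mathcal A\}$. $\mathfrak M$ is a model of $(\mathcal O,\mathcal A)$ if it is a model of $\mathcal O$ and $\ell\in A^{\mathfrak M}$ for all $A(\ell)\in\mathcal A$. The set of certain answers is $\mathrm{ans}(\boldsymbol q,\mathcal A)=\{\ell\in\mathrm{tem}(\mathcal A)\mid \ell\in\varkappa^{\mathfrak M}\text{ for every model }\mathfrak M\text{ of }(\mathcal O,\mathcal A)\}$. $\mathfrak S_{\mathcal A}$ is the finite first-order structure with domain $\mathrm{tem}(\mathcal A)$ ordered by $<$, in which $\mathfrak S_{\mathcal A}\models A(\ell)$ iff $A(\ell)\in\mathcal A$, for every atomic concept $A$ (viewed as a unary predicate). $\mathrm{FO}(<)$ is first-order logic over the unary predicates $A_i$ and the binary predicate $<$. *)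

theory Defs
  imports Main
begin

text \<open>The atomic concept with index \<open>i\<close> is represented by the natural number \<open>i\<close>.\<close>

type_synonym concept = nat

datatype prior =
    Atom concept
  | Top
  | Bot
  | Neg prior
  | Conj prior prior
  | Disj prior prior
  | Impl prior prior
  | Equi prior prior
  | BoxF prior
  | BoxP prior
  | DiaF prior
  | DiaP prior

type_synonym temp_interp = "concept \<Rightarrow> int set"

primrec ext :: "temp_interp \<Rightarrow> prior \<Rightarrow> int set" where
  "ext M (Atom A) = M A"
| "ext M Top = UNIV"
| "ext M Bot = {}"
| "ext M (Neg \<phi>) = - ext M \<phi>"
| "ext M (Conj \<phi> \<psi>) = ext M \<phi> \<inter> ext M \<psi>"
| "ext M (Disj \<phi> \<psi>) = ext M \<phi> \<union> ext M \<psi>"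
| "ext M (Impl \<phi> \<psi>) = - ext M \<phi> \<union> ext M \<psi>"
| "ext M (Equi \<phi> \<psi>) = {n. n \<in> ext M \<phi> \<longleftrightarrow> n \<in> ext M \<psi>}"
| "ext M (BoxF \<phi>) = {n. \<forall>k>n. k \<in> ext M \<phi>}"
| "ext M (BoxP \<phi>) = {n. \<forall>k<n. k \<in> ext M \<phi>}"
| "ext M (DiaF \<phi>) = {n. \<exists>k>n. k \<in> ext M \<phi>}"
| "ext M (DiaP \<phi>) = {n. \<exists>k<n. k \<in> ext M \<phi>}"

definition prior_ontology :: "prior set \<Rightarrow> bool" where
  "prior_ontology \<O> \<longleftrightarrow> finite \<O>"

definition ontology_model :: "temp_interp \<Rightarrow> prior set \<Rightarrow> bool" where
  "ontology_model M \<O> \<longleftrightarrow> (\<forall>\<alpha>\<in>\<O>. ext M \<alpha> = UNIV)"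

text \<open>The pair \<open>(A, l)\<close> stands for the ground atom \<open>A(l)\<close>.\<close>

type_synonym data = "(concept \<times> int) set"

definition min_data :: "data \<Rightarrow> int" where
  "min_data \<A> = Min (snd ` \<A>)"

definition max_data :: "data \<Rightarrow> int" where
  "max_data \<A> = Max (snd ` \<A>)"

text \<open>Non-emptiness is implicit in the existence of the least and greatest timestamps;
  it is stated because \<^const>\<open>Min\<close> and \<^const>\<open>Max\<close> are unspecified on the empty set.\<close>

definition data_instance :: "data \<Rightarrow> bool" where
  "data_instance \<A> \<longleftrightarrow> finite \<A> \<and> \<A> \<noteq> {} \<and> min_data \<A> = 0 \<and> max_data \<A> \<ge> 1"

definition tem :: "data \<Rightarrow> int set" where
  "tem \<A> = {n. min_data \<A> \<le> n \<and> n \<le> max_data \<A>}"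

definition kb_model :: "temp_interp \<Rightarrow> prior set \<Rightarrow> data \<Rightarrow> bool" where
  "kb_model M \<O> \<A> \<longleftrightarrow> ontology_model M \<O> \<and> (\<forall>(A, l)\<in>\<A>. l \<in> M A)"

type_synonym omq = "prior set \<times> prior"

definition ans :: "omq \<Rightarrow> data \<Rightarrow> int set" where
  "ans q \<A> = {l \<in> tem \<A>. \<forall>M. kb_model M (fst q) \<A> \<longrightarrow> l \<in> ext M (snd q)}"

text \<open>Terms are variables only, so every formula is constant-free.\<close>

type_synonym var = nat

datatype fo =
    FPred concept var
  | FLess var var
  | FEq var var
  | FNeg fo
  | FConj fo fo
  | FDisj fo fo
  | FImpl fo fo
  | FAll var fo
  | FEx var fo

primrec fv :: "fo \<Rightarrow> var set" where
  "fv (FPred A x) = {x}"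
| "fv (FLess x y) = {x, y}"
| "fv (FEq x y) = {x, y}"
| "fv (FNeg Q) = fv Q"
| "fv (FConj Q R) = fv Q \<union> fv R"
| "fv (FDisj Q R) = fv Q \<union> fv R"
| "fv (FImpl Q R) = fv Q \<union> fv R"
| "fv (FAll x Q) = fv Q - {x}"
| "fv (FEx x Q) = fv Q - {x}"

record 'd fo_structure =
  universe :: "'d set"
  less_rel :: "'d \<Rightarrow> 'd \<Rightarrow> bool"
  pred_rel :: "concept \<Rightarrow> 'd \<Rightarrow> bool"

primrec sat :: "'d fo_structure \<Rightarrow> (var \<Rightarrow> 'd) \<Rightarrow> fo \<Rightarrow> bool" where
  "sat S v (FPred A x) \<longleftrightarrow> pred_rel S A (v x)"
| "sat S v (FLess x y) \<longleftrightarrow> less_rel S (v x) (v y)"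
| "sat S v (FEq x y) \<longleftrightarrow> v x = v y"
| "sat S v (FNeg Q) \<longleftrightarrow> \<not> sat S v Q"
| "sat S v (FConj Q R) \<longleftrightarrow> sat S v Q \<and> sat S v R"
| "sat S v (FDisj Q R) \<longleftrightarrow> sat S v Q \<or> sat S v R"
| "sat S v (FImpl Q R) \<longleftrightarrow> (sat S v Q \<longrightarrow> sat S v R)"
| "sat S v (FAll x Q) \<longleftrightarrow> (\<forall>d\<in>universe S. sat S (v(x := d)) Q)"
| "sat S v (FEx x Q) \<longleftrightarrow> (\<exists>d\<in>universe S. sat S (v(x := d)) Q)"

lemma sat_cong_fv: "(\<And>x. x \<in> fv Q \<Longrightarrow> v x = w x) \<Longrightarrow> sat S v Q \<longleftrightarrow> sat S w Q"
proof (induction Q arbitrary: v w)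
  case (FNeg Q)
  have "sat S v Q = sat S w Q" by (rule FNeg.IH) (simp add: FNeg.prems)
  then show ?case by simp
next
  case (FConj Q R)
  have "sat S v Q = sat S w Q" by (rule FConj.IH(1)) (simp add: FConj.prems)
  moreover have "sat S v R = sat S w R" by (rule FConj.IH(2)) (simp add: FConj.prems)
  ultimately show ?case by simp
next
  case (FDisj Q R)
  have "sat S v Q = sat S w Q" by (rule FDisj.IH(1)) (simp add: FDisj.prems)
  moreover have "sat S v R = sat S w R" by (rule FDisj.IH(2)) (simp add: FDisj.prems)
  ultimately show ?case by simp
next
  case (FImpl Q R)
  have "sat S v Q = sat S w Q" by (rule FImpl.IH(1)) (simp add: FImpl.prems)
  moreover have "sat S v R = sat S w R" by (rule FImpl.IH(2)) (simp add: FImpl.prems)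
  ultimately show ?case by simp
next
  case (FAll x Q)
  have "sat S (v(x := d)) Q = sat S (w(x := d)) Q" for d
    by (rule FAll.IH) (simp add: FAll.prems)
  then show ?case by simp
next
  case (FEx x Q)
  have "sat S (v(x := d)) Q = sat S (w(x := d)) Q" for d
    by (rule FEx.IH) (simp add: FEx.prems)
  then show ?case by simp
qed simp_all

text \<open>For a formula \<open>Q\<close> with a single free variable, the truth of \<open>Q(d)\<close> does not depend on the
  values of the other variables, so all of them may be sent to \<open>d\<close>; see \<open>sat_at_iff\<close>.\<close>

definition sat_at :: "'d fo_structure \<Rightarrow> fo \<Rightarrow> 'd \<Rightarrow> bool" where
  "sat_at S Q d \<longleftrightarrow> sat S (\<lambda>_. d) Q"

lemma sat_at_iff: "fv Q = {t} \<Longrightarrow> sat_at S Q d \<longleftrightarrow> sat S (v(t := d)) Q"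
  unfolding sat_at_def by (rule sat_cong_fv) simp

definition data_structure :: "data \<Rightarrow> int fo_structure" where
  "data_structure \<A> =
    \<lparr>universe = tem \<A>, less_rel = (<), pred_rel = (\<lambda>A l. (A, l) \<in> \<A>)\<rparr>"

definition fo_rewritable :: "omq \<Rightarrow> bool" where
  "fo_rewritable q \<longleftrightarrow>
    (\<exists>Q t. fv Q = {t} \<and>
      (\<forall>\<A>. data_instance \<A> \<longrightarrow>
        ans q \<A> = {l \<in> tem \<A>. sat_at (data_structure \<A>) Q l}))"

end

theory Submission
  imports Defs
begin

text \<open>
  Whether a formula \<open>\<psi>\<close> holds somewhere to the right of \<open>n\<close> depends only on the position of \<open>n\<close>
  relative to the last point of \<open>\<psi>\<close>, if there is one; similarly for the left and for the
  complement of \<open>\<psi>\<close>. So a counter-model \<open>M\<close> of \<open>(\<O>, \<A>)\<close> has boundedly many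
  relevant points: the extremal points of the subformulas and of their complements. If
  \<open>(\<A>, l)\<close> and \<open>(\<A>', l')\<close> satisfy the same first-order formulas of a quantifier rank exceeding
  that bound, the relevant points in \<open>tem \<A>\<close> have counterparts in \<open>tem \<A>'\<close>, and there is a map
  \<open>f\<close> of the integers, a translation outside \<open>tem \<A>'\<close>, that sends counterparts to relevant
  points, keeps all other points on the correct side of them and preserves the data. Then \<open>f -` M\<close>
  is a counter-model for \<open>(\<A>', l')\<close>. Hence certain answers are a union of classes of
  a finite-index equivalence with first-order definable classes.
\<close>

section \<open>Formulas of bounded quantifier rank\<close>

text \<open>\<open>fo\<close> has no truth constants, so \<open>FEq 0 0\<close> stands in as the
  unit. It keeps variable 0 free even for an empty list, so a rewriting built from these has free
  variables exactly \<open>{0}\<close>.\<close>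

definition big_conj :: "fo list \<Rightarrow> fo" where
  "big_conj Qs = foldr FConj Qs (FEq 0 0)"

definition big_disj :: "fo list \<Rightarrow> fo" where
  "big_disj Qs = foldr FDisj Qs (FNeg (FEq 0 0))"

lemma sat_big_conj [simp]: "sat S v (big_conj Qs) \<longleftrightarrow> (\<forall>Q\<in>set Qs. sat S v Q)"
  unfolding big_conj_def by (induction Qs) auto

lemma sat_big_disj [simp]: "sat S v (big_disj Qs) \<longleftrightarrow> (\<exists>Q\<in>set Qs. sat S v Q)"
  unfolding big_disj_def by (induction Qs) auto

lemma fv_big_conj [simp]: "fv (big_conj Qs) = insert 0 (\<Union>Q\<in>set Qs. fv Q)"
  unfolding big_conj_def by (induction Qs) auto

lemma fv_big_disj [simp]: "fv (big_disj Qs) = insert 0 (\<Union>Q\<in>set Qs. fv Q)"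
  unfolding big_disj_def by (induction Qs) auto

definition exact_conj :: "fo list \<Rightarrow> fo set \<Rightarrow> fo" where
  "exact_conj Qs T = big_conj (map (\<lambda>Q. if Q \<in> T then Q else FNeg Q) Qs)"

lemma sat_exact_conj: "sat S v (exact_conj Qs T) \<longleftrightarrow> (\<forall>Q\<in>set Qs. sat S v Q \<longleftrightarrow> Q \<in> T)"
  unfolding exact_conj_def sat_big_conj set_map ball_simps(9) by auto

lemma fv_exact_conj: "fv (exact_conj Qs T) = insert 0 (\<Union>Q\<in>set Qs. fv Q)"
  unfolding exact_conj_def by auto

text \<open>Truth values of \<open>rank_formulas cs q k\<close> determine the rank-\<open>q\<close> Hintikka type of the
  tuple assigned to the variables \<open>0, \<dots>, k - 1\<close>, with respect to the predicates in \<open>cs\<close>.\<close>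

fun rank_formulas :: "concept list \<Rightarrow> nat \<Rightarrow> nat \<Rightarrow> fo list" where
  "rank_formulas cs 0 k =
    [FPred A i. A \<leftarrow> cs, i \<leftarrow> [0..<k]] @
    [FLess i j. i \<leftarrow> [0..<k], j \<leftarrow> [0..<k]] @ [FEq i j. i \<leftarrow> [0..<k], j \<leftarrow> [0..<k]]"
| "rank_formulas cs (Suc q) k =
    (let Qs = rank_formulas cs q (Suc k)
     in [FEx k (exact_conj Qs (set Ts)). Ts \<leftarrow> subseqs Qs])"

lemma fv_rank_formulas:
  "0 < k \<Longrightarrow> Q \<in> set (rank_formulas cs q k) \<Longrightarrow> fv Q \<subseteq> {..<k}"
proof (induction cs q k arbitrary: Q rule: rank_formulas.induct)
  case (1 cs k)
  then show ?case by auto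
next
  case (2 cs q k)
  then show ?case by (fastforce simp: Let_def fv_exact_conj less_Suc_eq)
qed

section \<open>Equality of rank-\<open>q\<close> types of two tuples, with the Ehrenfeucht-Fraisse
  extension property\<close>

definition agree ::
  "concept list \<Rightarrow> nat \<Rightarrow> nat \<Rightarrow> 'd fo_structure \<Rightarrow> (var \<Rightarrow> 'd) \<Rightarrow>
    'e fo_structure \<Rightarrow> (var \<Rightarrow> 'e) \<Rightarrow> bool" where
  "agree cs q k S v S' v' \<longleftrightarrow>
    (\<forall>Q\<in>set (rank_formulas cs q k). sat S v Q \<longleftrightarrow> sat S' v' Q)"

lemma agree_sym: "agree cs q k S v S' v' \<Longrightarrow> agree cs q k S' v' S v"
  unfolding agree_def by auto

lemma agree_0:
  "agree cs 0 k S v S' v' \<longleftrightarrow>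
    (\<forall>A\<in>set cs. \<forall>i<k. pred_rel S A (v i) \<longleftrightarrow> pred_rel S' A (v' i)) \<and>
    (\<forall>i<k. \<forall>j<k. less_rel S (v i) (v j) \<longleftrightarrow> less_rel S' (v' i) (v' j)) \<and>
    (\<forall>i<k. \<forall>j<k. v i = v j \<longleftrightarrow> v' i = v' j)"
  unfolding agree_def by (auto simp: ball_Un)

text \<open>One round of the game: the type of the tuple extended by \<open>d\<close> is asserted,
  behind an existential quantifier, by one of the formulas of rank \<open>Suc q\<close>. The other
  structure satisfies it too, and its witness is the reply. The converse direction comes from
  \<open>agree_sym\<close>.\<close>

lemma agree_extend:
  assumes "agree cs (Suc q) k S v S' v'" and "d \<in> universe S"
  obtains d' where "d' \<in> universe S'" and "agree cs q (Suc k) S (v(k := d)) S' (v'(k := d'))"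
proof -
  define Qs where "Qs = rank_formulas cs q (Suc k)"
  define Ts where "Ts = filter (sat S (v(k := d))) Qs"
  have "set Ts \<in> set ` set (subseqs Qs)"
    by (auto simp: Ts_def subseqs_powset)
  then have "FEx k (exact_conj Qs (set Ts)) \<in> set (rank_formulas cs (Suc q) k)"
    by (auto simp: Let_def Qs_def)
  moreover have "sat S v (FEx k (exact_conj Qs (set Ts)))"
    using assms(2) by (auto simp: sat_exact_conj Ts_def)
  ultimately have "sat S' v' (FEx k (exact_conj Qs (set Ts)))"
    using assms(1) unfolding agree_def by blast
  then obtain d' where "d' \<in> universe S'"
    and "\<forall>Q\<in>set Qs. sat S' (v'(k := d')) Q \<longleftrightarrow> Q \<in> set Ts"
    by (auto simp: sat_exact_conj)
  then show thesis
    by (intro that) (auto simp: agree_def Ts_def Qs_def)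
qed

text \<open>Playing the points of \<open>ds\<close> one after another costs one rank each and leaves
  \<open>q\<close> rounds.\<close>

lemma agree_extend_list:
  assumes "agree cs (length ds + q) k S v S' v'" and "set ds \<subseteq> universe S"
    and "v ` {..<k} \<subseteq> universe S" and "v' ` {..<k} \<subseteq> universe S'"
  shows "\<exists>w w'. agree cs q (length ds + k) S w S' w' \<and>
    (\<forall>i<k. w i = v i \<and> w' i = v' i) \<and> set ds \<subseteq> w ` {..<length ds + k} \<and>
    w ` {..<length ds + k} \<subseteq> universe S \<and> w' ` {..<length ds + k} \<subseteq> universe S'"
  using assms
proof (induction ds arbitrary: k v v')
  case Nil
  then show ?case by auto
next
  case (Cons d ds)
  obtain d' where d': "d' \<in> universe S'"
    "agree cs (length ds + q) (Suc k) S (v(k := d)) S' (v'(k := d'))"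
    using agree_extend[of cs "length ds + q" k S v S' v' d] Cons.prems by auto
  have "\<exists>w w'. agree cs q (length ds + Suc k) S w S' w' \<and>
    (\<forall>i<Suc k. w i = (v(k := d)) i \<and> w' i = (v'(k := d')) i) \<and>
    set ds \<subseteq> w ` {..<length ds + Suc k} \<and>
    w ` {..<length ds + Suc k} \<subseteq> universe S \<and> w' ` {..<length ds + Suc k} \<subseteq> universe S'"
  proof (rule Cons.IH)
    show "agree cs (length ds + q) (Suc k) S (v(k := d)) S' (v'(k := d'))" by (rule d'(2))
  qed (use d'(1) Cons.prems in \<open>auto simp: less_Suc_eq\<close>)
  then obtain w w' where w: "agree cs q (length ds + Suc k) S w S' w'"
    "\<forall>i<Suc k. w i = (v(k := d)) i \<and> w' i = (v'(k := d')) i"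
    "set ds \<subseteq> w ` {..<length ds + Suc k}"
    "w ` {..<length ds + Suc k} \<subseteq> universe S" "w' ` {..<length ds + Suc k} \<subseteq> universe S'"
    by blast
  have "w k = d" using w(2) by simp
  then have "d \<in> w ` {..<length ds + Suc k}" by force
  moreover have "\<forall>i<k. w i = v i \<and> w' i = v' i"
    using w(2) by (metis fun_upd_other less_SucI less_irrefl)
  ultimately show ?case using w by (intro exI[of _ w] exI[of _ w']) auto
qed

text \<open>The finite list \<open>Qs\<close> allows only finitely many truth patterns. By
  invariance, the disjunction of the patterns realised by certain answers, over all data instances,
  defines the certain answers.\<close>

lemma rewritable_if_agree_invariant:
  assumes "\<And>\<A> \<A>' l l'. \<lbrakk>data_instance \<A>; data_instance \<A>'; l \<in> tem \<A>; l' \<in> tem \<A>';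
      agree cs q 1 (data_structure \<A>) (\<lambda>_. l) (data_structure \<A>') (\<lambda>_. l'); l \<in> ans om \<A>\<rbrakk>
    \<Longrightarrow> l' \<in> ans om \<A>'"
  shows "fo_rewritable om"
proof -
  define Qs where "Qs = rank_formulas cs q 1"
  define true_at where
    "true_at = (\<lambda>\<A> l. filter (\<lambda>Q. sat (data_structure \<A>) (\<lambda>_. l) Q) Qs)"
  define good where
    "good = (\<lambda>T. \<exists>\<A> l. data_instance \<A> \<and> l \<in> ans om \<A> \<and> T = set (true_at \<A> l))"
  define Q where
    "Q = big_disj [exact_conj Qs (set Ts). Ts \<leftarrow> filter (\<lambda>Ts. good (set Ts)) (subseqs Qs)]"
  have fv: "fv Q = {0}"
  proof -
    have "fv R \<subseteq> {0}" if "R \<in> set Qs" for R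
      using fv_rank_formulas[of 1 R cs q] that by (auto simp: Qs_def)
    then show ?thesis by (auto simp: Q_def fv_exact_conj)
  qed
  have "ans om \<A> = {l \<in> tem \<A>. sat_at (data_structure \<A>) Q l}" if \<A>: "data_instance \<A>" for \<A>
  proof (intro set_eqI iffI)
    fix l assume l: "l \<in> ans om \<A>"
    have "set (true_at \<A> l) \<in> set ` set (subseqs Qs)"
      by (auto simp: true_at_def subseqs_powset)
    then obtain Ts where Ts: "Ts \<in> set (subseqs Qs)" "set Ts = set (true_at \<A> l)" by auto
    moreover have "good (set Ts)"
      using \<A> l Ts(2) unfolding good_def by blast
    moreover have "sat (data_structure \<A>) (\<lambda>_. l) (exact_conj Qs (set Ts))"
      unfolding sat_exact_conj Ts(2) by (auto simp: true_at_def)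
    ultimately have "sat_at (data_structure \<A>) Q l"
      unfolding sat_at_def Q_def by auto
    moreover have "l \<in> tem \<A>" using l by (simp add: ans_def)
    ultimately show "l \<in> {l \<in> tem \<A>. sat_at (data_structure \<A>) Q l}" by simp
  next
    fix l assume "l \<in> {l \<in> tem \<A>. sat_at (data_structure \<A>) Q l}"
    then obtain Ts where l: "l \<in> tem \<A>" and Ts: "good (set Ts)"
      "sat (data_structure \<A>) (\<lambda>_. l) (exact_conj Qs (set Ts))"
      by (auto simp: sat_at_def Q_def)
    obtain \<A>' l' where *: "data_instance \<A>'" "l' \<in> ans om \<A>'" "set Ts = set (true_at \<A>' l')"
      using Ts(1) by (auto simp: good_def)
    have "agree cs q 1 (data_structure \<A>') (\<lambda>_. l') (data_structure \<A>) (\<lambda>_. l)"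
      using Ts(2) unfolding sat_exact_conj *(3) agree_def by (auto simp: true_at_def Qs_def)
    moreover have "l' \<in> tem \<A>'" using *(2) by (simp add: ans_def)
    ultimately show "l \<in> ans om \<A>" using assms * \<A> l by blast
  qed
  with fv show ?thesis unfolding fo_rewritable_def by blast
qed

section \<open>Pulling back interpretations\<close>

primrec subf :: "prior \<Rightarrow> prior set" where
  "subf (Atom A) = {Atom A}"
| "subf Top = {Top}"
| "subf Bot = {Bot}"
| "subf (Neg \<phi>) = insert (Neg \<phi>) (subf \<phi>)"
| "subf (Conj \<phi> \<psi>) = insert (Conj \<phi> \<psi>) (subf \<phi> \<union> subf \<psi>)"
| "subf (Disj \<phi> \<psi>) = insert (Disj \<phi> \<psi>) (subf \<phi> \<union> subf \<psi>)"
| "subf (Impl \<phi> \<psi>) = insert (Impl \<phi> \<psi>) (subf \<phi> \<union> subf \<psi>)"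
| "subf (Equi \<phi> \<psi>) = insert (Equi \<phi> \<psi>) (subf \<phi> \<union> subf \<psi>)"
| "subf (BoxF \<phi>) = insert (BoxF \<phi>) (subf \<phi>)"
| "subf (BoxP \<phi>) = insert (BoxP \<phi>) (subf \<phi>)"
| "subf (DiaF \<phi>) = insert (DiaF \<phi>) (subf \<phi>)"
| "subf (DiaP \<phi>) = insert (DiaP \<phi>) (subf \<phi>)"

lemma finite_subf: "finite (subf \<phi>)"
  by (induction \<phi>) auto

lemma subf_refl: "\<phi> \<in> subf \<phi>"
  by (cases \<phi>) auto

section \<open>Maps whose preimages commute with the temporal operators\<close>

text \<open>This is the condition for \<open>f -\<close> to commute with \<open>DiaF\<close> at
  \<open>S\<close>. It does not force \<open>f\<close> to be monotone. Applied to the complement, it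
  covers \<open>BoxF\<close> by duality.\<close>

definition future_faithful :: "(int \<Rightarrow> int) \<Rightarrow> int set \<Rightarrow> bool" where
  "future_faithful f S \<longleftrightarrow> (\<forall>n. (\<exists>k>n. f k \<in> S) \<longleftrightarrow> (\<exists>j>f n. j \<in> S))"

definition past_faithful :: "(int \<Rightarrow> int) \<Rightarrow> int set \<Rightarrow> bool" where
  "past_faithful f S \<longleftrightarrow> (\<forall>n. (\<exists>k<n. f k \<in> S) \<longleftrightarrow> (\<exists>j<f n. j \<in> S))"

definition faithful :: "(int \<Rightarrow> int) \<Rightarrow> int set \<Rightarrow> bool" where
  "faithful f S \<longleftrightarrow>
    future_faithful f S \<and> future_faithful f (- S) \<and> past_faithful f S \<and> past_faithful f (- S)"

lemma ext_vimage:
  assumes "\<And>\<psi>. \<psi> \<in> subf \<phi> \<Longrightarrow> faithful f (ext M \<psi>)"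
    and "\<And>A. Atom A \<in> subf \<phi> \<Longrightarrow> M' A = f -` M A"
  shows "ext M' \<phi> = f -` ext M \<phi>"
  using assms
proof (induction \<phi>)
  case (BoxF \<phi>)
  have "future_faithful f (- ext M \<phi>)"
    using BoxF.prems(1)[of \<phi>] by (simp add: subf_refl faithful_def)
  moreover have "ext M' \<phi> = f -` ext M \<phi>" by (rule BoxF.IH) (simp_all add: BoxF.prems)
  ultimately show ?case by (auto simp: future_faithful_def)
next
  case (BoxP \<phi>)
  have "past_faithful f (- ext M \<phi>)"
    using BoxP.prems(1)[of \<phi>] by (simp add: subf_refl faithful_def)
  moreover have "ext M' \<phi> = f -` ext M \<phi>" by (rule BoxP.IH) (simp_all add: BoxP.prems)
  ultimately show ?case by (auto simp: past_faithful_def)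
next
  case (DiaF \<phi>)
  have "future_faithful f (ext M \<phi>)"
    using DiaF.prems(1)[of \<phi>] by (simp add: subf_refl faithful_def)
  moreover have "ext M' \<phi> = f -` ext M \<phi>" by (rule DiaF.IH) (simp_all add: DiaF.prems)
  ultimately show ?case by (auto simp: future_faithful_def)
next
  case (DiaP \<phi>)
  have "past_faithful f (ext M \<phi>)"
    using DiaP.prems(1)[of \<phi>] by (simp add: subf_refl faithful_def)
  moreover have "ext M' \<phi> = f -` ext M \<phi>" by (rule DiaP.IH) (simp_all add: DiaP.prems)
  ultimately show ?case by (auto simp: past_faithful_def)
qed auto

section \<open>Faithfulness from control of extremal points\<close>

text \<open>The counterpart \<open>w'\<close> is the only preimage of \<open>w\<close>, and
  \<open>f\<close> keeps every other point on its side; among themselves, points on one side may be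
  permuted or merged.\<close>

definition tracked :: "(int \<Rightarrow> int) \<Rightarrow> int \<Rightarrow> bool" where
  "tracked f w \<longleftrightarrow> (\<exists>w'. \<forall>n. (f n < w \<longleftrightarrow> n < w') \<and> (f n = w \<longleftrightarrow> n = w'))"

definition is_max :: "int set \<Rightarrow> int \<Rightarrow> bool" where
  "is_max S w \<longleftrightarrow> w \<in> S \<and> (\<forall>j\<in>S. j \<le> w)"

definition is_min :: "int set \<Rightarrow> int \<Rightarrow> bool" where
  "is_min S w \<longleftrightarrow> w \<in> S \<and> (\<forall>j\<in>S. w \<le> j)"

lemma is_max_exists:
  assumes "s \<in> S" and "\<forall>j\<in>S. j \<le> b"
  shows "\<exists>w. is_max S w"
proof -
  let ?T = "S \<inter> {s..b}"
  have "finite ?T" "?T \<noteq> {}" using assms by auto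
  then have "Max ?T \<in> ?T" "\<forall>j\<in>?T. j \<le> Max ?T" by (rule Max_in) (simp add: \<open>finite ?T\<close>)
  then have "is_max S (Max ?T)"
    using assms unfolding is_max_def by (metis IntI IntD1 IntD2 atLeastAtMost_iff linear order_trans)
  then show ?thesis ..
qed

text \<open>If \<open>S\<close> has a maximum, both sides say that \<open>n\<close> lies before its
  counterpart. If \<open>S\<close> is empty, both fail. If \<open>S\<close> is unbounded above, both
  hold, because \<open>f\<close> is eventually a translation and so reaches points of
  \<open>S\<close> arbitrarily late.\<close>

lemma future_faithfulI:
  assumes shift: "\<And>n. N < n \<Longrightarrow> f n = n + c"
    and max: "\<And>w. is_max S w \<Longrightarrow> tracked f w"
  shows "future_faithful f S"
  unfolding future_faithful_def
proof
  fix n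
  show "(\<exists>k>n. f k \<in> S) \<longleftrightarrow> (\<exists>j>f n. j \<in> S)"
  proof (cases "\<exists>w. is_max S w")
    case True
    then obtain w where w: "is_max S w" ..
    obtain w' where w': "\<And>n. f n < w \<longleftrightarrow> n < w'" "\<And>n. f n = w \<longleftrightarrow> n = w'"
      using max[OF w] unfolding tracked_def by blast
    have "f k \<le> w \<longleftrightarrow> k \<le> w'" for k
      using w'[of k] by (auto simp: le_less)
    \<comment> \<open>For the direction from right to left the witness is \<open>w'\<close>, since
      \<open>f w' = w\<close> lies in \<open>S\<close>.\<close>
    then have "(\<exists>k>n. f k \<in> S) \<longleftrightarrow> n < w'"
      using w w'(2)[of w'] unfolding is_max_def by (metis le_less_trans less_le_trans)
    moreover have "(\<exists>j>f n. j \<in> S) \<longleftrightarrow> f n < w"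
      using w unfolding is_max_def by (metis less_le_trans)
    ultimately show ?thesis using w'(1) by simp
  next
    case False
    show ?thesis
    proof (cases "S = {}")
      case False
      then have unb: "\<exists>j\<in>S. b < j" for b
        using is_max_exists[of _ S b] \<open>\<nexists>w. is_max S w\<close> by (meson all_not_in_conv not_le)
      \<comment> \<open>The bound puts \<open>j - c\<close> beyond both \<open>n\<close> and
        \<open>N\<close>, so it is a later point in the translation range.\<close>
      obtain j where j: "j \<in> S" "\<bar>n\<bar> + \<bar>N\<bar> + c < j" using unb by blast
      then have "f (j - c) = j" by (simp add: shift)
      then have "\<exists>k>n. f k \<in> S" using j by (intro exI[of _ "j - c"]) auto
      moreover have "\<exists>j>f n. j \<in> S" using unb[of "f n"] by blast
      ultimately show ?thesis by simp
    qed simp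
  qed
qed

lemma is_max_uminus: "is_max (uminus ` S) w \<longleftrightarrow> is_min S (- w)"
  unfolding is_max_def is_min_def
  by (auto simp: image_iff minus_le_iff intro: bexI[of _ "- w"])

lemma past_faithfulI:
  assumes shift: "\<And>n. n < N \<Longrightarrow> f n = n + c"
    and min: "\<And>w. is_min S w \<Longrightarrow> tracked f w"
  shows "past_faithful f S"
proof -
  \<comment> \<open>Conjugating \<open>f\<close> with the reflection of the integers swaps past and
    future and turns the shift \<open>c\<close> into \<open>- c\<close>.\<close>
  define g where "g n = - f (- n)" for n
  have "tracked g w" if "is_max (uminus ` S) w" for w
  proof -
    have "is_min S (- w)" using that by (simp add: is_max_uminus)
    then obtain w' where w': "\<And>n. f n < - w \<longleftrightarrow> n < w'" "\<And>n. f n = - w \<longleftrightarrow> n = w'"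
      using min[of "- w"] unfolding tracked_def by blast
    have "(g n < w \<longleftrightarrow> n < - w') \<and> (g n = w \<longleftrightarrow> n = - w')" for n
      using w'[of "- n"] by (auto simp: g_def)
    then show ?thesis unfolding tracked_def by blast
  qed
  then have fut: "future_faithful g (uminus ` S)"
    by (intro future_faithfulI[of "- N" g "- c"]) (auto simp: g_def shift)
  have mem: "- j \<in> uminus ` S \<longleftrightarrow> j \<in> S" for j
    by (auto simp: image_iff)
  have neg: "(\<exists>k::int. k > - n \<and> P k) \<longleftrightarrow> (\<exists>k<n. P (- k))" for n P
    by (metis minus_minus neg_less_iff_less)
  have "(\<exists>k<n. f k \<in> S) \<longleftrightarrow> (\<exists>j<f n. j \<in> S)" for n
  proof -
    have "(\<exists>k>- n. g k \<in> uminus ` S) \<longleftrightarrow> (\<exists>j>- f n. j \<in> uminus ` S)"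
      using fut unfolding future_faithful_def by (simp add: g_def)
    then show ?thesis unfolding neg by (simp add: g_def mem)
  qed
  then show ?thesis unfolding past_faithful_def by blast
qed

section \<open>Transfer of counter-models\<close>

definition extremal :: "int set \<Rightarrow> int \<Rightarrow> bool" where
  "extremal S w \<longleftrightarrow> is_max S w \<or> is_min S w \<or> is_max (- S) w \<or> is_min (- S) w"

lemma faithfulI:
  assumes "\<And>n. n < N \<Longrightarrow> f n = n + c" and "\<And>n. N' < n \<Longrightarrow> f n = n + c'"
    and "\<And>w. extremal S w \<Longrightarrow> tracked f w"
  shows "faithful f S"
  unfolding faithful_def using assms
  by (auto intro!: future_faithfulI[of N' f c'] past_faithfulI[of N f c] simp: extremal_def)

lemma card_extremal: "finite {w. extremal S w} \<and> card {w. extremal S w} \<le> 4"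
proof -
  have max: "\<exists>x. {w. is_max T w} \<subseteq> {x}" for T
    unfolding is_max_def by (blast intro: antisym)
  have min: "\<exists>x. {w. is_min T w} \<subseteq> {x}" for T
    unfolding is_min_def by (blast intro: antisym)
  obtain a b c d where "{w. is_max S w} \<subseteq> {a}" "{w. is_min S w} \<subseteq> {b}"
    "{w. is_max (- S) w} \<subseteq> {c}" "{w. is_min (- S) w} \<subseteq> {d}"
    using max min by metis
  then have sub: "{w. extremal S w} \<subseteq> set [a, b, c, d]"
    unfolding extremal_def by auto
  then show ?thesis
    using card_mono[OF finite_set sub] card_length[of "[a, b, c, d]"] finite_subset[OF sub] by simp
qed

text \<open>Each subformula contributes at most four extremal points. Padding with \<open>l\<close>
  makes the length independent of \<open>M\<close>, so that one quantifier rank serves all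
  counter-models.\<close>

lemma marked_points_list:
  assumes "finite \<Phi>" and "l \<in> X"
  obtains ds where "length ds = 4 * card \<Phi>" and "set ds \<subseteq> X"
    and "\<And>\<psi> w. \<psi> \<in> \<Phi> \<Longrightarrow> extremal (ext M \<psi>) w \<Longrightarrow> w \<in> X \<Longrightarrow> w \<in> set ds"
proof -
  define W where "W = (\<Union>\<psi>\<in>\<Phi>. {w. extremal (ext M \<psi>) w}) \<inter> X"
  have fin: "finite (\<Union>\<psi>\<in>\<Phi>. {w. extremal (ext M \<psi>) w})"
    using assms(1) card_extremal by auto
  then have "finite W" by (simp add: W_def)
  have "card W \<le> card (\<Union>\<psi>\<in>\<Phi>. {w. extremal (ext M \<psi>) w})"
    unfolding W_def by (intro card_mono fin) auto
  also have "\<dots> \<le> (\<Sum>\<psi>\<in>\<Phi>. card {w. extremal (ext M \<psi>) w})"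
    by (rule card_UN_le[OF assms(1)])
  also have "\<dots> \<le> 4 * card \<Phi>"
    using sum_bounded_above[of \<Phi> "\<lambda>\<psi>. card {w. extremal (ext M \<psi>) w}" 4] card_extremal by simp
  finally have "card W \<le> 4 * card \<Phi>" .
  obtain ws where ws: "set ws = W" "distinct ws"
    using finite_distinct_list[OF \<open>finite W\<close>] by blast
  then have len: "length ws \<le> 4 * card \<Phi>"
    using \<open>card W \<le> 4 * card \<Phi>\<close> distinct_card by metis
  show thesis
  proof (rule that[of "ws @ replicate (4 * card \<Phi> - length ws) l"])
    show "set (ws @ replicate (4 * card \<Phi> - length ws) l) \<subseteq> X"
      using ws(1) assms(2) by (auto simp: W_def)
  qed (use len ws(1) in \<open>auto simp: W_def\<close>)
qed

lemma tem_eq: "data_instance \<A> \<Longrightarrow> tem \<A> = {0..max_data \<A>}"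
  by (auto simp: data_instance_def tem_def)

text \<open>Of the \<open>4 * card \<Phi> + 1\<close> rounds, all but the last place the marked
  points of \<open>M\<close>. The last one finds, separately for each point of
  \<open>tem \<A>'\<close>, an image in \<open>tem \<A>\<close> with the same data and the same
  position relative to the marked points.\<close>

lemma counter_model_transfer:
  assumes data: "data_instance \<A>" "data_instance \<A>'"
    and l: "l \<in> tem \<A>" "l' \<in> tem \<A>'"
    and \<Phi>: "\<Phi> = (\<Union>\<phi>\<in>insert \<kappa> \<O>. subf \<phi>)" "finite \<Phi>"
    and cs: "set cs = {A. Atom A \<in> \<Phi>}"
    and agree: "agree cs (4 * card \<Phi> + 1) 1
      (data_structure \<A>) (\<lambda>_. l) (data_structure \<A>') (\<lambda>_. l')"
    and M: "kb_model M \<O> \<A>" "l \<notin> ext M \<kappa>"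
  shows "\<exists>M'. kb_model M' \<O> \<A>' \<and> l' \<notin> ext M' \<kappa>"
proof -
  let ?S = "data_structure \<A>" and ?S' = "data_structure \<A>'"
  define m m' where "m = max_data \<A>" and "m' = max_data \<A>'"
  have tem: "tem \<A> = {0..m}" "tem \<A>' = {0..m'}" "1 \<le> m" "1 \<le> m'"
    using data by (simp_all add: tem_eq m_def m'_def) (simp_all add: data_instance_def)
  have univ: "universe ?S = {0..m}" "universe ?S' = {0..m'}"
    by (simp_all add: data_structure_def tem)
  obtain ds where ds: "length ds = 4 * card \<Phi>" "set ds \<subseteq> {0..m}"
    "\<And>\<psi> w. \<psi> \<in> \<Phi> \<Longrightarrow> extremal (ext M \<psi>) w \<Longrightarrow> w \<in> {0..m} \<Longrightarrow> w \<in> set ds"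
    using marked_points_list[OF \<Phi>(2), of l "{0..m}" M] l(1) tem by auto
  \<comment> \<open>One more than the marked points, because index 0 holds \<open>l\<close> and
    \<open>l'\<close>.\<close>
  define K where "K = length ds + 1"
  have "\<exists>v v'. agree cs 1 K ?S v ?S' v' \<and> (\<forall>i<1. v i = l \<and> v' i = l') \<and>
      set ds \<subseteq> v ` {..<K} \<and> v ` {..<K} \<subseteq> universe ?S \<and> v' ` {..<K} \<subseteq> universe ?S'"
    unfolding K_def
    by (rule agree_extend_list) (use agree ds univ l tem in auto)
  then obtain v v' where v: "agree cs 1 K ?S v ?S' v'" "v 0 = l" "v' 0 = l'"
    "set ds \<subseteq> v ` {..<K}" "v ` {..<K} \<subseteq> {0..m}" "v' ` {..<K} \<subseteq> {0..m'}"
    by (auto simp: univ)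
  \<comment> \<open>\<open>R n d\<close> says that \<open>d\<close> is an admissible image of
    \<open>n\<close>.\<close>
  define R where "R n d \<longleftrightarrow> d \<in> {0..m} \<and>
    (\<forall>A\<in>set cs. (A, d) \<in> \<A> \<longleftrightarrow> (A, n) \<in> \<A>') \<and>
    (\<forall>i<K. (d < v i \<longleftrightarrow> n < v' i) \<and> (d = v i \<longleftrightarrow> n = v' i))" for n d
  have "\<exists>d. R n d" if "n \<in> {0..m'}" for n
  proof -
    \<comment> \<open>The last round is played in the opposite direction: \<open>n\<close> is chosen
      in the second structure and answered in the first.\<close>
    have "agree cs (Suc 0) K ?S' v' ?S v" using agree_sym[OF v(1)] by simp
    moreover have "n \<in> universe ?S'" using that univ by simp
    ultimately obtain d where "d \<in> universe ?S"
      and d: "agree cs 0 (Suc K) ?S' (v'(K := n)) ?S (v(K := d))"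
      by (rule agree_extend)
    have P: "\<forall>A\<in>set cs. \<forall>i<Suc K. (A, (v'(K := n)) i) \<in> \<A>' \<longleftrightarrow> (A, (v(K := d)) i) \<in> \<A>"
      and L: "\<forall>i<Suc K. \<forall>j<Suc K. (v'(K := n)) i < (v'(K := n)) j \<longleftrightarrow>
        (v(K := d)) i < (v(K := d)) j"
      and E: "\<forall>i<Suc K. \<forall>j<Suc K. (v'(K := n)) i = (v'(K := n)) j \<longleftrightarrow>
        (v(K := d)) i = (v(K := d)) j"
      using d unfolding agree_0 by (simp_all add: data_structure_def)
    have "(d < v i \<longleftrightarrow> n < v' i) \<and> (d = v i \<longleftrightarrow> n = v' i)" if "i < K" for i
      using L[rule_format, of K i] E[rule_format, of K i] that by simp
    moreover have "(A, d) \<in> \<A> \<longleftrightarrow> (A, n) \<in> \<A>'" if "A \<in> set cs" for A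
      using P[rule_format, of A K] that by simp
    ultimately show ?thesis using \<open>d \<in> universe ?S\<close> univ unfolding R_def by blast
  qed
  then obtain g where "\<And>n. n \<in> {0..m'} \<Longrightarrow> R n (g n)"
    by metis
  then have g: "n \<in> {0..m'} \<Longrightarrow> g n \<in> {0..m}"
    "\<And>A. n \<in> {0..m'} \<Longrightarrow> A \<in> set cs \<Longrightarrow> (A, g n) \<in> \<A> \<longleftrightarrow> (A, n) \<in> \<A>'"
    "\<And>i. n \<in> {0..m'} \<Longrightarrow> i < K \<Longrightarrow> g n < v i \<longleftrightarrow> n < v' i"
    "\<And>i. n \<in> {0..m'} \<Longrightarrow> i < K \<Longrightarrow> g n = v i \<longleftrightarrow> n = v' i" for n
    unfolding R_def by blast+
  \<comment> \<open>Both active domains start at 0, so the left part is the identity; the right part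
    sends \<open>m' + 1\<close> to \<open>m + 1\<close>.\<close>
  define f where "f n = (if n < 0 then n else if n \<le> m' then g n else n - m' + m)" for n
  have f: "f n = n" if "n < 0" for n using that by (simp add: f_def)
  have f': "f n = n - m' + m" if "m' < n" for n using that tem by (simp add: f_def)
  have fg: "f n = g n" if "n \<in> {0..m'}" for n using that by (simp add: f_def)
  have cases_n: "n < 0 \<or> n \<in> {0..m'} \<or> m' < n" for n by auto
  have tracked_v: "tracked f (v i)" if i: "i < K" for i
  proof -
    have b: "v i \<in> {0..m}" "v' i \<in> {0..m'}" using v i by auto
    have "(f n < v i \<longleftrightarrow> n < v' i) \<and> (f n = v i \<longleftrightarrow> n = v' i)" for n
      using cases_n[of n] b f[of n] f'[of n] fg[of n] g(3)[of n i] g(4)[of n i] i by auto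
    then show ?thesis unfolding tracked_def by blast
  qed
  \<comment> \<open>Extremal points of \<open>M\<close> outside \<open>tem \<A>\<close> need no game
    moves: as \<open>g\<close> stays within \<open>{0..m}\<close>, the two translations give them
    counterparts.\<close>
  have tracked_left: "tracked f w" if "w < 0" for w
  proof -
    have "(f n < w \<longleftrightarrow> n < w) \<and> (f n = w \<longleftrightarrow> n = w)" for n
      using cases_n[of n] that tem f[of n] f'[of n] fg[of n] g(1)[of n] by auto
    then show ?thesis unfolding tracked_def by blast
  qed
  have tracked_right: "tracked f w" if "m < w" for w
  proof -
    have "(f n < w \<longleftrightarrow> n < w - m + m') \<and> (f n = w \<longleftrightarrow> n = w - m + m')" for n
      using cases_n[of n] that tem f[of n] f'[of n] fg[of n] g(1)[of n] by auto
    then show ?thesis unfolding tracked_def by blast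
  qed
  have faithful: "faithful f (ext M \<psi>)" if "\<psi> \<in> \<Phi>" for \<psi>
  proof (rule faithfulI[of 0 f 0 m' "m - m'"])
    fix w assume w: "extremal (ext M \<psi>) w"
    show "tracked f w"
    proof (cases "w \<in> {0..m}")
      case True
      then have "w \<in> v ` {..<K}" using ds(3)[OF that w] v(4) by blast
      then show ?thesis using tracked_v by blast
    next
      case False
      then show ?thesis using tracked_left tracked_right by auto
    qed
  qed (simp_all add: f f')
  \<comment> \<open>Concepts outside \<open>cs\<close> occur in no relevant formula; making them
    true everywhere satisfies whatever \<A>' asserts about them.\<close>
  define M' where "M' A = (if A \<in> set cs then f -` M A else UNIV)" for A
  have ext: "ext M' \<phi> = f -` ext M \<phi>" if "\<phi> \<in> insert \<kappa> \<O>" for \<phi>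
  proof (rule ext_vimage)
    fix \<psi> assume "\<psi> \<in> subf \<phi>"
    then show "faithful f (ext M \<psi>)" using that \<Phi>(1) faithful by blast
  next
    fix A assume "Atom A \<in> subf \<phi>"
    then have "A \<in> set cs" using that \<Phi>(1) cs by blast
    then show "M' A = f -` M A" by (simp add: M'_def)
  qed
  have "n \<in> M' A" if "(A, n) \<in> \<A>'" for A n
  proof (cases "A \<in> set cs")
    case True
    have "finite (snd ` \<A>')" using data(2) by (simp add: data_instance_def)
    moreover have "n \<in> snd ` \<A>'" using that by force
    ultimately have "n \<in> tem \<A>'" by (simp add: tem_def min_data_def max_data_def)
    then have "(A, f n) \<in> \<A>" using g(2) True that tem fg by auto
    then have "f n \<in> M A" using M(1) unfolding kb_model_def by blast
    then show ?thesis using True by (simp add: M'_def)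
  qed (simp add: M'_def)
  moreover have "ontology_model M' \<O>"
    using M(1) ext unfolding kb_model_def ontology_model_def by auto
  ultimately have "kb_model M' \<O> \<A>'" unfolding kb_model_def by blast
  \<comment> \<open>Index 0 of the tuples pairs \<open>l'\<close> with \<open>l\<close>, so
    \<open>g\<close> must send one to the other.\<close>
  moreover have "f l' = l"
    using fg[of l'] g(4)[of l' 0] v(2,3) l(2) tem by (simp add: K_def)
  then have "l' \<notin> ext M' \<kappa>" using ext[of \<kappa>] M(2) by simp
  ultimately show ?thesis by blast
qed

theorem theoremA:
  fixes \<O> :: "prior set" and \<kappa> :: prior
  assumes "prior_ontology \<O>"
  shows "fo_rewritable (\<O>, \<kappa>)"
proof -
  define \<Phi> where "\<Phi> = (\<Union>\<phi>\<in>insert \<kappa> \<O>. subf \<phi>)"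
  have fin: "finite \<Phi>"
    using assms by (simp add: \<Phi>_def prior_ontology_def finite_subf)
  have "finite (Atom -` \<Phi>)"
    using fin by (rule finite_vimageI) (simp add: inj_def)
  then obtain cs where cs: "set cs = {A. Atom A \<in> \<Phi>}"
    using finite_list by (auto simp: vimage_def)
  show ?thesis
  proof (rule rewritable_if_agree_invariant[of cs "4 * card \<Phi> + 1"])
    fix \<A> \<A>' l l'
    assume *: "data_instance \<A>" "data_instance \<A>'" "l \<in> tem \<A>" "l' \<in> tem \<A>'"
      "agree cs (4 * card \<Phi> + 1) 1 (data_structure \<A>) (\<lambda>_. l) (data_structure \<A>') (\<lambda>_. l')"
      "l \<in> ans (\<O>, \<kappa>) \<A>"
    show "l' \<in> ans (\<O>, \<kappa>) \<A>'"
    proof (rule ccontr)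
      assume "l' \<notin> ans (\<O>, \<kappa>) \<A>'"
      then obtain M where "kb_model M \<O> \<A>'" "l' \<notin> ext M \<kappa>"
        using *(4) by (auto simp: ans_def)
      \<comment> \<open>The transfer runs with the roles of the two instances exchanged, carrying a
        counter-model at \<open>l'\<close> back to one at \<open>l\<close>.\<close>
      then obtain M' where "kb_model M' \<O> \<A>" "l \<notin> ext M' \<kappa>"
        using counter_model_transfer[OF *(2,1,4,3) \<Phi>_def fin cs agree_sym[OF *(5)]] by blast
      then show False using *(6) by (simp add: ans_def)
    qed
  qed
qed

end
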